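(* Let $\{X_i, i\ge 1\}$ be independent and identically distributed random variables with $P\{X_1=0\}=P\{X_1=1\}=\frac12$, and let $M_N$ be the number of switches of the longest run of consecutive switches in $(X_1,\dots,X_N)$. Let $\varepsilon$ be any positive number. Then for almost all $\omega\in\Omega$ there exists a finite $N_0=N_0(\omega,\varepsilon)$ such that $$M_N\ge\left[\log N-\log\log\log N+\log\log e-1-\varepsilon\right]$$ if $N\ge N_0$.
   Context: All random variables are defined on a probability space $(\Omega,\mathcal F,P)$. The symbol $\log$ denotes the logarithm with base $2$, $e$ is the base of the natural logarithm, and $[x]$ is the largest integer which is no more than $x$. For integers $m,n\ge 1$ let $$S_n^{(m)}=\sum_{i=m+1}^{n+m-1}(1-X_{i-1})X_i+\sum_{i=m+1}^{n+m-1}X_{i-1}(1-X_i),$$ which is the total number of switches (indices $i$ with $X_{i-1}\neq X_i$) in the block $(X_m,\dots,X_{m+n-1})$ (an empty sum is $0$, so $S_1^{(m)}=0$). For integers $i,N\ge 1$ and $1\le n\le N$ let $H_{n,i}^{(N)}=\bigcup_{i\le m\le i+N-n}\{S_n^{(m)}=n-1\}$, the event that some block of $n$ consecutive terms of $(X_i,\dots,X_{i+N-1})$ consists entirely of switches. Define the random variable $M_N^{(i)}(\omega)=\max\{n-1: 1\le n\le N,\ \omega\in H_{n,i}^{(N)}\}$ and $M_N=M_N^{(1)}$. *)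

theory Defs
  imports "HOL-Probability.Probability"
begin

text \<open>
  The sequence is \<open>X 1, X 2, \<dots>\<close>; the value \<open>X 0\<close> is never used as long as \<open>m \<ge> 1\<close>. The
  variables are real-valued, so they are \<open>0\<close> or \<open>1\<close> only almost surely, and the number of switches
  \<open>S\<^sub>n\<^sup>(\<^sup>m\<^sup>)\<close> is accordingly real-valued.
\<close>

definition switches :: "(nat \<Rightarrow> 'a \<Rightarrow> real) \<Rightarrow> nat \<Rightarrow> nat \<Rightarrow> 'a \<Rightarrow> real" where
  "switches X m n \<omega> =
     (\<Sum>i = m + 1..n + m - 1. (1 - X (i - 1) \<omega>) * X i \<omega>) +
     (\<Sum>i = m + 1..n + m - 1. X (i - 1) \<omega> * (1 - X i \<omega>))"

text \<open>The event \<open>H\<close>; meant for \<open>i \<ge> 1\<close> and \<open>1 \<le> n \<le> N\<close>, so that the subtractions on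
  natural numbers do not truncate.\<close>

definition switch_run_event ::
  "'a measure \<Rightarrow> (nat \<Rightarrow> 'a \<Rightarrow> real) \<Rightarrow> nat \<Rightarrow> nat \<Rightarrow> nat \<Rightarrow> 'a set" where
  "switch_run_event M X N n i =
     (\<Union>m\<in>{i..i + N - n}. {\<omega> \<in> space M. switches X m n \<omega> = real (n - 1)})"

text \<open>For \<open>N \<ge> 1\<close> and \<open>\<omega> \<in> space M\<close> the maximum is over a finite set that contains \<open>0\<close>,
  because \<open>n = 1\<close> always qualifies.\<close>

definition longest_switch_run_from ::
  "'a measure \<Rightarrow> (nat \<Rightarrow> 'a \<Rightarrow> real) \<Rightarrow> nat \<Rightarrow> nat \<Rightarrow> 'a \<Rightarrow> nat" where
  "longest_switch_run_from M X i N \<omega> =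
     Max {n - 1 | n. 1 \<le> n \<and> n \<le> N \<and> \<omega> \<in> switch_run_event M X N n i}"

definition longest_switch_run ::
  "'a measure \<Rightarrow> (nat \<Rightarrow> 'a \<Rightarrow> real) \<Rightarrow> nat \<Rightarrow> 'a \<Rightarrow> nat" where
  "longest_switch_run M X N \<omega> = longest_switch_run_from M X 1 N \<omega>"

end

theory Submission
  imports Defs "HOL-Real_Asymp.Real_Asymp"
begin

text \<open>
  Let \<open>p n\<close> be the probability that there is no run of \<open>k\<close> switches in the first \<open>n\<close> terms. A first
  run of \<open>k\<close> switches is completed at time \<open>n + 1\<close> as soon as there is none up to time \<open>n - k\<close>, no
  switch between \<open>n - k\<close> and \<open>n - k + 1\<close>, and switches from then on; given the past this has
  probability \<open>2\<close> to the power \<open>-(k + 1)\<close>. As \<open>p\<close> is decreasing, it follows that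
  \<open>p (n + 1) \<le> (1 - (1/2)^(k + 1)) p n\<close>, so that \<open>p n\<close> is at most about \<open>exp (- n / 2^(k + 1))\<close>.
  At \<open>n \<approx> 2^(k + 1 + \<epsilon>) ln k\<close> these bounds are summable over \<open>k\<close>, and the Borel--Cantelli lemma
  applies; solving for \<open>k\<close> in terms of \<open>n\<close> gives the claim.
\<close>

section \<open>Runs of switches in a single Boolean sequence\<close>

definition has_switch_run :: "nat \<Rightarrow> nat \<Rightarrow> (nat \<Rightarrow> bool) \<Rightarrow> bool" where
  "has_switch_run k n f \<longleftrightarrow> (\<exists>m\<in>{1..n - k}. m + k \<le> n \<and> (\<forall>i\<in>{m + 1..m + k}. f (i - 1) \<noteq> f i))"

lemma has_switch_runI:
  assumes "m \<ge> 1" "m + k \<le> n" "\<And>i. m < i \<Longrightarrow> i \<le> m + k \<Longrightarrow> f (i - 1) \<noteq> f i"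
  shows "has_switch_run k n f"
  unfolding has_switch_run_def using assms by (intro bexI[of _ m]) auto

lemma has_switch_runE:
  assumes "has_switch_run k n f"
  obtains m where "m \<ge> 1" "m + k \<le> n" "\<And>i. m < i \<Longrightarrow> i \<le> m + k \<Longrightarrow> f (i - 1) \<noteq> f i"
  using assms unfolding has_switch_run_def by (metis Suc_eq_plus1 Suc_leI atLeastAtMost_iff)

lemma has_switch_run_mono: "has_switch_run k n f \<Longrightarrow> n \<le> n' \<Longrightarrow> has_switch_run k n' f"
  by (elim has_switch_runE, intro has_switch_runI) auto

text \<open>Only the terms \<open>1..n\<close> are inspected, since
  \<open>i - 1 \<ge> m \<ge> 1\<close> in every comparison. This makes the absence of a run an event
  of the prefix, and hence independent of all later terms.\<close>

lemma has_switch_run_restrict [simp]: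
  "has_switch_run k n (restrict f {1..n}) \<longleftrightarrow> has_switch_run k n f"
proof -
  have "(\<forall>i\<in>{m + 1..m + k}. restrict f {1..n} (i - 1) \<noteq> restrict f {1..n} i) \<longleftrightarrow>
      (\<forall>i\<in>{m + 1..m + k}. f (i - 1) \<noteq> f i)"
    if "m \<in> {1..n - k}" "m + k \<le> n" for m
    using that by (intro ball_cong refl) auto
  then show ?thesis
    unfolding has_switch_run_def by (intro bex_cong refl) blast
qed

text \<open>The term at \<open>m + 1\<close> repeats the one at \<open>m\<close>. A run of
  \<open>k\<close> switches within the first \<open>m + k\<close> terms therefore either ends by
  \<open>m\<close>, which is excluded, or starts by \<open>m\<close> and would have to switch at
  this repetition. From \<open>m + 1\<close> on the terms alternate, and this gives the run that
  ends at \<open>m + k + 1\<close>.\<close>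

lemma alternating_completes_run:
  assumes m: "m \<ge> 1" and no: "\<not> has_switch_run k m f"
    and alt: "\<And>i. m < i \<Longrightarrow> i \<le> m + k + 1 \<Longrightarrow> f i = (f m = even (i - (m + 1)))"
  shows "\<not> has_switch_run k (m + k) f" "has_switch_run k (m + k + 1) f"
proof -
  show "\<not> has_switch_run k (m + k) f"
  proof
    assume "has_switch_run k (m + k) f"
    then obtain l where l: "l \<ge> 1" "l + k \<le> m + k" "\<And>i. l < i \<Longrightarrow> i \<le> l + k \<Longrightarrow> f (i - 1) \<noteq> f i"
      by (elim has_switch_runE) blast
    show False
    proof (cases "l + k \<le> m")
      case True
      with l no show False by (metis has_switch_runI)
    next
      case False
      then have "f m \<noteq> f (m + 1)"
        using l(3)[of "m + 1"] l(2) by auto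
      then show False using alt[of "m + 1"] by auto
    qed
  qed
  show "has_switch_run k (m + k + 1) f"
  proof (rule has_switch_runI[of "m + 1"])
    fix i assume i: "m + 1 < i" "i \<le> m + 1 + k"
    then have "even (i - (m + 1)) \<noteq> even (i - 1 - (m + 1))"
      by presburger
    moreover have "f i = (f m = even (i - (m + 1)))"
      by (rule alt) (use i in linarith)+
    moreover have "f (i - 1) = (f m = even (i - 1 - (m + 1)))"
      by (rule alt) (use i in linarith)+
    ultimately show "f (i - 1) \<noteq> f i" by blast
  qed auto
qed

section \<open>From Boolean runs to the switch count and the longest run\<close>

lemma switches_eq_length:
  assumes "\<And>i. i \<ge> 1 \<Longrightarrow> X i \<omega> \<in> {0, 1}" and "m \<ge> 1"
    and "\<And>i. m < i \<Longrightarrow> i \<le> m + k \<Longrightarrow> (X (i - 1) \<omega> = 1) \<noteq> (X i \<omega> = 1)"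
  shows "switches X m (k + 1) \<omega> = real k"
proof -
  have "switches X m (k + 1) \<omega> =
      (\<Sum>i = m + 1..m + k. (1 - X (i - 1) \<omega>) * X i \<omega> + X (i - 1) \<omega> * (1 - X i \<omega>))"
    unfolding switches_def by (simp add: sum.distrib add.commute)
  \<comment> \<open>For values 0 and 1 the two products indicate a switch upwards and a switch
    downwards, so exactly one of them is 1 at each switch.\<close>
  also have "\<dots> = (\<Sum>i = m + 1..m + k. 1)"
  proof (rule sum.cong)
    fix i assume "i \<in> {m + 1..m + k}"
    then have "m < i" "i \<le> m + k" by auto
    then show "(1 - X (i - 1) \<omega>) * X i \<omega> + X (i - 1) \<omega> * (1 - X i \<omega>) = 1"
      using assms(1)[of i] assms(1)[of "i - 1"] assms(2) assms(3)[of i] by auto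
  qed simp
  finally show ?thesis by simp
qed

text \<open>A run of \<open>k\<close> switches occupies \<open>k + 1\<close> terms, so the block to
  exhibit has \<open>n = k + 1\<close>, and it enters the maximum as
  \<open>n - 1 = k\<close>.\<close>

lemma longest_switch_run_ge:
  assumes "\<omega> \<in> space M" and "\<And>i. i \<ge> 1 \<Longrightarrow> X i \<omega> \<in> {0, 1}"
    and "has_switch_run k N (\<lambda>i. X i \<omega> = 1)"
  shows "k \<le> longest_switch_run M X N \<omega>"
proof -
  obtain m where m: "m \<ge> 1" "m + k \<le> N"
    "\<And>i. m < i \<Longrightarrow> i \<le> m + k \<Longrightarrow> (X (i - 1) \<omega> = 1) \<noteq> (X i \<omega> = 1)"
    using assms(3) by (elim has_switch_runE) blast
  have "switches X m (k + 1) \<omega> = real k"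
    using assms(2) m(1,3) by (rule switches_eq_length) auto
  then have "\<omega> \<in> switch_run_event M X N (k + 1) 1"
    using assms(1) m unfolding switch_run_event_def by (intro UN_I[of m]) auto
  then have "k \<in> {n - 1 | n. 1 \<le> n \<and> n \<le> N \<and> \<omega> \<in> switch_run_event M X N n 1}"
    using m by (intro CollectI exI[of _ "k + 1"]) auto
  moreover have "finite {n - 1 | n. 1 \<le> n \<and> n \<le> N \<and> \<omega> \<in> switch_run_event M X N n 1}"
    by (rule finite_subset[of _ "{..N}"]) auto
  ultimately show ?thesis
    unfolding longest_switch_run_def longest_switch_run_from_def by (rule Max_ge[rotated])
qed

section \<open>The probability that no run of \<open>k\<close> switches has occurred\<close>

lemma (in prob_space) prob_pattern_after_prefix:
  fixes B :: "nat \<Rightarrow> 'a \<Rightarrow> bool"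
  assumes ind: "indep_vars (\<lambda>_. count_space UNIV) B {1..}"
    and half: "\<And>i c. i \<ge> 1 \<Longrightarrow> prob {\<omega> \<in> space M. B i \<omega> = c} = 1 / 2"
    and A: "A \<in> sets (PiM {1..m} (\<lambda>_. count_space UNIV))"
  shows "prob {\<omega> \<in> space M. (\<lambda>i\<in>{1..m}. B i \<omega>) \<in> A \<and> (\<forall>i\<in>{m + 1..m + k}. B i \<omega> = c i)} =
    prob {\<omega> \<in> space M. (\<lambda>i\<in>{1..m}. B i \<omega>) \<in> A} / 2 ^ k"
proof -
  let ?J = "{m + 1..m + k}" and ?I = "{1..m}"
  let ?f = "\<lambda>\<omega>. \<lambda>i\<in>?I. B i \<omega>" and ?g = "\<lambda>\<omega>. \<lambda>i\<in>?J. B i \<omega>"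
  define C where "C = {g \<in> space (PiM ?J (\<lambda>_. count_space UNIV)). \<forall>i\<in>?J. g i = c i}"
  have C: "C \<in> sets (PiM ?J (\<lambda>_. count_space UNIV))"
    unfolding C_def by measurable
  have gC: "?g \<omega> \<in> C \<longleftrightarrow> (\<forall>i\<in>?J. B i \<omega> = c i)" for \<omega>
    by (auto simp: C_def space_PiM)
  \<comment> \<open>Blocks of an independent family over disjoint index sets are
    independent.\<close>
  have iv: "indep_var (PiM ?I (\<lambda>_. count_space UNIV)) ?f (PiM ?J (\<lambda>_. count_space UNIV)) ?g"
    by (rule indep_var_restrict[OF ind]) auto
  have "prob {\<omega> \<in> space M. ?f \<omega> \<in> A \<and> (\<forall>i\<in>?J. B i \<omega> = c i)} = prob ((\<lambda>\<omega>. (?f \<omega>, ?g \<omega>)) -` (A \<times> C) \<inter> space M)"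
    unfolding vimage_def Int_def mem_Collect_eq mem_Times_iff fst_conv snd_conv gC
    by (simp add: conj_commute)
  also have "\<dots> = prob (?f -` A \<inter> space M) * prob (?g -` C \<inter> space M)"
    using indep_varD[OF iv A C] .
  also have "prob (?g -` C \<inter> space M) = 1 / 2 ^ k"
  \<comment> \<open>The product formula needs a nonempty index set; an empty intersection would be
    \<open>UNIV\<close> and not \<open>space M\<close>.\<close>
  proof (cases "k = 0")
    case True
    then have "?g -` C \<inter> space M = space M" using gC by auto
    then show ?thesis using True by (simp add: prob_space)
  next
    case False
    have "?g -` C \<inter> space M = {\<omega> \<in> space M. \<forall>i\<in>?J. B i \<omega> = c i}"
      unfolding vimage_def Int_def mem_Collect_eq gC by (simp add: conj_commute)
    also have "\<dots> = (\<Inter>i\<in>?J. B i -` {c i} \<inter> space M)"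
      using False by auto
    also have "prob \<dots> = (\<Prod>i\<in>?J. prob (B i -` {c i} \<inter> space M))"
      using False by (intro indep_varsD[OF ind]) auto
    also have "\<dots> = (\<Prod>i\<in>?J. 1 / 2)"
    proof (rule prod.cong)
      fix i assume "i \<in> ?J"
      moreover have "B i -` {c i} \<inter> space M = {\<omega> \<in> space M. B i \<omega> = c i}" by auto
      ultimately show "prob (B i -` {c i} \<inter> space M) = 1 / 2" using half[of i "c i"] by auto
    qed simp
    finally show ?thesis by (simp add: power_one_over)
  qed
  also have "?f -` A \<inter> space M = {\<omega> \<in> space M. ?f \<omega> \<in> A}" by auto
  finally show ?thesis unfolding times_divide_eq_right mult_1_right .
qed

lemma (in prob_space) no_switch_run_measurable:
  fixes B :: "nat \<Rightarrow> 'a \<Rightarrow> bool"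
  assumes "indep_vars (\<lambda>_. count_space UNIV) B {1..}"
  shows "{\<omega> \<in> space M. \<not> has_switch_run k n (\<lambda>i. B i \<omega>)} \<in> events"
proof -
  have [measurable]: "B i \<in> measurable M (count_space UNIV)" if "i \<ge> 1" for i
    using assms that unfolding indep_vars_def by auto
  \<comment> \<open>Nothing is known about \<open>B 0\<close>. Windows start at
    \<open>m \<ge> 1\<close>, so \<open>i \<ge> 2\<close> is all that is required.\<close>
  have "{\<omega> \<in> space M. B (i - 1) \<omega> \<noteq> B i \<omega>} \<in> events" if "i \<ge> 2" for i
  proof -
    have "1 \<le> i - 1" "1 \<le> i" using that by auto
    then show ?thesis by measurable
  qed
  then have run: "{\<omega> \<in> space M. m + k \<le> n \<and> (\<forall>i\<in>{m + 1..m + k}. B (i - 1) \<omega> \<noteq> B i \<omega>)} \<in> events"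
    if "m \<ge> 1" for m
    using that by (intro sets.sets_Collect_conj sets.sets_Collect_finite_All) auto
  have "{\<omega> \<in> space M. has_switch_run k n (\<lambda>i. B i \<omega>)} \<in> events"
    unfolding has_switch_run_def
    by (rule sets.sets_Collect_finite_Ex[OF run]) simp_all
  then show ?thesis by (rule sets.sets_Collect_neg)
qed

text \<open>What is lost from time \<open>m + k\<close> to \<open>m + k + 1\<close> contains the
  outcomes with no run up to \<open>m\<close>, then one repetition, then \<open>k\<close> switches.
  Once the value at \<open>m\<close> is fixed, this continuation is a prescribed pattern of
  \<open>k + 1\<close> fair bits.\<close>

lemma (in prob_space) prob_no_switch_run_step:
  fixes B :: "nat \<Rightarrow> 'a \<Rightarrow> bool"
  assumes ind: "indep_vars (\<lambda>_. count_space UNIV) B {1..}"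
    and half: "\<And>i c. i \<ge> 1 \<Longrightarrow> prob {\<omega> \<in> space M. B i \<omega> = c} = 1 / 2"
    and m: "m \<ge> 1"
  shows "prob {\<omega> \<in> space M. \<not> has_switch_run k (m + k + 1) (\<lambda>i. B i \<omega>)} \<le>
    prob {\<omega> \<in> space M. \<not> has_switch_run k (m + k) (\<lambda>i. B i \<omega>)} * (1 - 1 / 2 ^ (k + 1))"
proof -
  define E where "E n = {\<omega> \<in> space M. \<not> has_switch_run k n (\<lambda>i. B i \<omega>)}" for n
  define A where "A b = {f \<in> space (PiM {1..m} (\<lambda>_. count_space UNIV)).
    f m = b \<and> \<not> has_switch_run k m f}" for b
  \<comment> \<open>Splitting by the value \<open>b\<close> at \<open>m\<close> makes the pattern
    independent of the prefix. It starts with \<open>b\<close> at \<open>i = m + 1\<close>, because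
    \<open>i - (m + 1) = 0\<close> is even, and alternates from there.\<close>
  define D where "D b = {\<omega> \<in> space M. (\<lambda>i\<in>{1..m}. B i \<omega>) \<in> A b \<and>
    (\<forall>i\<in>{m + 1..m + (k + 1)}. B i \<omega> = (b = even (i - (m + 1))))}" for b
  have [measurable]: "B i \<in> measurable M (count_space UNIV)" if "i \<ge> 1" for i
    using ind that unfolding indep_vars_def by auto
  have E: "E n \<in> events" for n
    unfolding E_def by (rule no_switch_run_measurable[OF ind])
  have EA: "{\<omega> \<in> space M. (\<lambda>i\<in>{1..m}. B i \<omega>) \<in> A b} = {\<omega> \<in> E m. B m \<omega> = b}" for b
    using m by (auto simp: A_def E_def space_PiM simp flip: One_nat_def)
  have Eb: "{\<omega> \<in> E m. B m \<omega> = b} \<in> events" for b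
  proof -
    have "{\<omega> \<in> E m. B m \<omega> = b} = E m \<inter> {\<omega> \<in> space M. B m \<omega> = b}"
      by (auto simp: E_def)
    then show ?thesis using m E by auto
  qed
  have D: "D b \<in> events" for b
  proof -
    have "D b = {\<omega> \<in> E m. B m \<omega> = b} \<inter>
      {\<omega> \<in> space M. \<forall>i\<in>{m + 1..m + (k + 1)}. B i \<omega> = (b = even (i - (m + 1)))}"
      unfolding D_def EA[symmetric] by auto
    moreover have "{\<omega> \<in> space M. \<forall>i\<in>{m + 1..m + (k + 1)}. B i \<omega> = (b = even (i - (m + 1)))} \<in> events"
      by (intro sets.sets_Collect_finite_All) auto
    ultimately show ?thesis using Eb by auto
  qed
  \<comment> \<open>A finite product of countable discrete spaces is discrete, so every set of
    Boolean prefixes is measurable.\<close>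
  have A: "A b \<in> sets (PiM {1..m} (\<lambda>_. count_space UNIV))" for b
    by (rule subsetD[of "Pow (space (PiM {1..m} (\<lambda>_. count_space UNIV)))"])
       (auto simp: A_def space_PiM count_space_PiM_finite)
  have "E m = {\<omega> \<in> E m. B m \<omega> = True} \<union> {\<omega> \<in> E m. B m \<omega> = False}"
    by auto
  then have "prob (E m) = prob {\<omega> \<in> E m. B m \<omega> = True} + prob {\<omega> \<in> E m. B m \<omega> = False}"
    using finite_measure_Union[OF Eb[of True] Eb[of False]] by auto
  moreover have "prob (D b) = prob {\<omega> \<in> E m. B m \<omega> = b} / 2 ^ (k + 1)" for b
    unfolding D_def EA[symmetric] by (rule prob_pattern_after_prefix[OF ind half A])
  ultimately have "prob (E m) / 2 ^ (k + 1) = prob (D True) + prob (D False)"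
    by (simp add: add_divide_distrib)
  also have "\<dots> = prob (D True \<union> D False)"
    by (rule finite_measure_Union[OF D D, symmetric]) (auto simp: D_def A_def)
  also have "\<dots> \<le> prob (E (m + k) - E (m + k + 1))"
  proof (rule finite_measure_mono)
    have "D b \<subseteq> E (m + k) - E (m + k + 1)" for b
    proof
      fix \<omega> assume \<omega>: "\<omega> \<in> D b"
      then have "\<omega> \<in> {\<omega> \<in> E m. B m \<omega> = b}"
        unfolding EA[symmetric] D_def by auto
      then show "\<omega> \<in> E (m + k) - E (m + k + 1)"
        using \<omega> alternating_completes_run[OF m, of k "\<lambda>i. B i \<omega>"]
        unfolding D_def E_def by auto
    qed
    then show "D True \<union> D False \<subseteq> E (m + k) - E (m + k + 1)" by blast
  qed (use E in auto)
  also have "\<dots> = prob (E (m + k)) - prob (E (m + k + 1))"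
    using E by (intro finite_measure_Diff) (auto simp: E_def intro: has_switch_run_mono)
  finally have "prob (E (m + k + 1)) \<le> prob (E (m + k)) - prob (E m) / 2 ^ (k + 1)"
    by simp
  \<comment> \<open>The loss is a fraction of \<open>prob (E m)\<close>. Bounding it below by the
    same fraction of \<open>prob (E (m + k))\<close> yields a recursion with step one.\<close>
  moreover have "prob (E (m + k)) \<le> prob (E m)"
    using E by (intro finite_measure_mono) (auto simp: E_def intro: has_switch_run_mono)
  then have "prob (E (m + k)) / 2 ^ (k + 1) \<le> prob (E m) / 2 ^ (k + 1)"
    by (rule divide_right_mono) simp
  ultimately show ?thesis
    unfolding E_def by (simp add: algebra_simps)
qed

text \<open>The step is iterated from time \<open>k + 1\<close>, the earliest at which it applies,
  and then \<open>1 - x \<le> exp (- x)\<close> is used. For smaller \<open>n\<close> the exponent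
  is nonnegative and the bound is trivial.\<close>

lemma (in prob_space) prob_no_switch_run_le:
  fixes B :: "nat \<Rightarrow> 'a \<Rightarrow> bool"
  assumes ind: "indep_vars (\<lambda>_. count_space UNIV) B {1..}"
    and half: "\<And>i c. i \<ge> 1 \<Longrightarrow> prob {\<omega> \<in> space M. B i \<omega> = c} = 1 / 2"
  shows "prob {\<omega> \<in> space M. \<not> has_switch_run k n (\<lambda>i. B i \<omega>)} \<le>
    exp (- (real n - real (k + 1)) / 2 ^ (k + 1))"
proof (cases "n \<le> k + 1")
  case True
  then have "1 \<le> exp (- (real n - real (k + 1)) / 2 ^ (k + 1))" by simp
  then show ?thesis using prob_le_1 by (rule order_trans[rotated])
next
  case False
  have "prob {\<omega> \<in> space M. \<not> has_switch_run k (l + 1 + k) (\<lambda>i. B i \<omega>)} \<le> (1 - 1 / 2 ^ (k + 1)) ^ l" for l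
  proof (induction l)
    case (Suc l)
    have "prob {\<omega> \<in> space M. \<not> has_switch_run k (Suc l + 1 + k) (\<lambda>i. B i \<omega>)} \<le>
      prob {\<omega> \<in> space M. \<not> has_switch_run k (l + 1 + k) (\<lambda>i. B i \<omega>)} * (1 - 1 / 2 ^ (k + 1))"
      using prob_no_switch_run_step[OF ind half, of "l + 1" k] by simp
    also have "\<dots> \<le> (1 - 1 / 2 ^ (k + 1)) ^ l * (1 - 1 / 2 ^ (k + 1))"
      using Suc one_le_power[of "2::real" "k + 1"] by (intro mult_right_mono) (auto simp: field_simps)
    finally show ?case by (simp add: mult.commute)
  qed simp
  from this[of "n - (k + 1)"] False
  have "prob {\<omega> \<in> space M. \<not> has_switch_run k n (\<lambda>i. B i \<omega>)} \<le> (1 - 1 / 2 ^ (k + 1)) ^ (n - (k + 1))"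
    by simp
  also have "\<dots> \<le> exp (- (1 / 2 ^ (k + 1))) ^ (n - (k + 1))"
    using exp_ge_add_one_self[of "- (1 / 2 ^ (k + 1))"] one_le_power[of "2::real" "k + 1"]
    by (intro power_mono) (simp_all del: power_Suc)
  also have "\<dots> = exp (- (real n - real (k + 1)) / 2 ^ (k + 1))"
    using False by (simp add: exp_of_nat_mult[symmetric] of_nat_diff field_simps)
  finally show ?thesis .
qed

section \<open>Borel--Cantelli along \<open>k\<close>, and inversion to statements about
  \<open>N\<close>\<close>

lemma (in prob_space) AE_eventually_switch_run:
  fixes B :: "nat \<Rightarrow> 'a \<Rightarrow> bool" and \<epsilon> :: real
  assumes ind: "indep_vars (\<lambda>_. count_space UNIV) B {1..}"
    and half: "\<And>i c. i \<ge> 1 \<Longrightarrow> prob {\<omega> \<in> space M. B i \<omega> = c} = 1 / 2"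
    and "\<epsilon> > 0"
  shows "AE \<omega> in M. \<forall>\<^sub>F k in sequentially.
    has_switch_run k (nat \<lceil>2 powr (real k + 1 + \<epsilon>) * ln (real k)\<rceil>) (\<lambda>i. B i \<omega>)"
proof -
  define L where "L k = nat \<lceil>2 powr (real k + 1 + \<epsilon>) * ln (real k)\<rceil>" for k
  define F where "F k = {\<omega> \<in> space M. \<not> has_switch_run k (L k) (\<lambda>i. B i \<omega>)}" for k
  have bound: "prob (F k) \<le> exp 1 * real k powr - (2 powr \<epsilon>)" if "k \<ge> 1" for k
  proof -
    have "2 powr (real k + 1 + \<epsilon>) * ln (real k) \<le> real (L k)"
      unfolding L_def by linarith
    then have "2 ^ (k + 1) * (2 powr \<epsilon> * ln (real k)) \<le> real (L k)"
      by (simp add: powr_add powr_realpow mult_ac)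
    then have "2 powr \<epsilon> * ln (real k) \<le> real (L k) / 2 ^ (k + 1)"
      by (simp add: field_simps)
    \<comment> \<open>The delay of \<open>k + 1\<close> terms before the decay begins costs only the
      constant factor \<open>exp 1\<close>.\<close>
    moreover have "real (k + 1) / 2 ^ (k + 1) \<le> 1"
      using of_nat_less_two_power[of "k + 1", where ?'a = real] by (simp add: field_simps)
    ultimately have "- (real (L k) - real (k + 1)) / 2 ^ (k + 1) \<le> 1 + - (2 powr \<epsilon>) * ln (real k)"
      unfolding minus_diff_eq diff_divide_distrib by linarith
    then have "exp (- (real (L k) - real (k + 1)) / 2 ^ (k + 1)) \<le> exp (1 + - (2 powr \<epsilon>) * ln (real k))"
      by simp
    also have "\<dots> = exp 1 * real k powr - (2 powr \<epsilon>)"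
      using that by (simp only: exp_add) (simp add: powr_def)
    finally show ?thesis
      using prob_no_switch_run_le[OF ind half, of k "L k"] unfolding F_def by linarith
  qed
  \<comment> \<open>The positive \<epsilon> pushes the exponent of the series past the critical
    value 1.\<close>
  have "1 < 2 powr \<epsilon>" using \<open>\<epsilon> > 0\<close> by simp
  then have "summable (\<lambda>k. exp 1 * real k powr - (2 powr \<epsilon>))"
    by (intro summable_mult) (simp add: summable_real_powr_iff)
  then have "summable (\<lambda>k. prob (F k))"
    by (rule summable_comparison_test'[of _ 1]) (use bound in auto)
  moreover have "F k \<in> events" for k
    unfolding F_def by (rule no_switch_run_measurable[OF ind])
  ultimately have "AE \<omega> in M. \<forall>\<^sub>F k in sequentially. \<omega> \<in> space M - F k"
    by (intro borel_cantelli_AE1) (auto simp: emeasure_eq_measure)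
  then show ?thesis
    by (rule AE_mp) (auto simp: F_def L_def elim: eventually_mono)
qed

text \<open>As \<open>k\<close> is at most \<open>log 2 N\<close>, the triple logarithm of
  \<open>N\<close> dominates \<open>log 2 (log 2 k)\<close>. Exponentiating then bounds
  \<open>2 powr (k + 1 + \<epsilon>)\<close> by \<open>N * log 2 (exp 1) / log 2 k\<close>, and the
  term \<open>log 2 (log 2 (exp 1))\<close> is exactly what turns \<open>log 2 k\<close> into
  \<open>ln k\<close>.\<close>

lemma run_length_threshold:
  fixes N k :: nat and \<epsilon> :: real
  assumes k: "k \<ge> 2" and N: "log 2 (log 2 (log 2 (real N))) \<ge> 0" "real N \<ge> 4"
    and "\<epsilon> > 0"
    and le: "real k \<le> log 2 (real N) - log 2 (log 2 (log 2 (real N))) + log 2 (log 2 (exp 1)) - 1 - \<epsilon>"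
  shows "nat \<lceil>2 powr (real k + 1 + \<epsilon>) * ln (real k)\<rceil> \<le> N"
proof -
  define l where "l = log 2 (real N)"
  have e: "log 2 (exp 1) = 1 / ln (2::real)" by (simp add: log_def)
  \<comment> \<open>A crude bound suffices: \<open>log 2 (log 2 (exp 1)) \<le> 1\<close> is absorbed
    by the \<open>- 1\<close> in the hypothesis on \<open>k\<close>.\<close>
  have "exp 1 \<le> (2::real) powr 2" using exp_le by simp
  then have "log 2 (exp 1) \<le> (2::real)" by (subst log_le_iff) auto
  then have "log 2 (log 2 (exp 1)) \<le> (1::real)"
    by (simp add: log_le_iff e)
  then have kl: "real k \<le> l" using le N(1) \<open>\<epsilon> > 0\<close> unfolding l_def by linarith
  have "0 < log 2 (real k)" using k by simp
  moreover have "log 2 (real k) \<le> log 2 l" using kl k by simp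
  ultimately have "log 2 (log 2 (real k)) \<le> log 2 (log 2 l)" by simp
  then have "real k + 1 + \<epsilon> \<le> l - log 2 (log 2 (real k)) + log 2 (log 2 (exp 1))"
    using le unfolding l_def by linarith
  then have "2 powr (real k + 1 + \<epsilon>) \<le> 2 powr (l - log 2 (log 2 (real k)) + log 2 (log 2 (exp 1)))"
    by simp
  also have "\<dots> = real N / log 2 (real k) * log 2 (exp 1)"
    using N(2) k e unfolding l_def by (simp add: powr_add powr_diff)
  also have "\<dots> = real N / ln (real k)"
    using k by (simp add: log_def)
  finally have "2 powr (real k + 1 + \<epsilon>) * ln (real k) \<le> real N"
    using k by (simp add: field_simps)
  then show ?thesis by (simp add: nat_le_iff ceiling_le_iff)
qed

theorem theorem3p2:
  fixes M :: "'a measure" and X :: "nat \<Rightarrow> 'a \<Rightarrow> real" and \<epsilon> :: real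
  assumes "prob_space M"
    and "prob_space.indep_vars M (\<lambda>_. borel) X {1..}"
    and "\<And>i. i \<ge> 1 \<Longrightarrow> distr M borel (X i) = distr M borel (X 1)"
    and "measure M {\<omega> \<in> space M. X 1 \<omega> = 0} = 1 / 2"
    and "measure M {\<omega> \<in> space M. X 1 \<omega> = 1} = 1 / 2"
    and "\<epsilon> > 0"
  shows "AE \<omega> in M. \<exists>N\<^sub>0. \<forall>N\<ge>N\<^sub>0.
    int (longest_switch_run M X N \<omega>) \<ge>
      \<lfloor>log 2 (real N) - log 2 (log 2 (log 2 (real N))) + log 2 (log 2 (exp 1)) - 1 - \<epsilon>\<rfloor>"
proof -
  interpret prob_space M by fact
  define f where "f N = log 2 (real N) - log 2 (log 2 (log 2 (real N))) + log 2 (log 2 (exp 1)) - 1 - \<epsilon>"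
    for N :: nat
  \<comment> \<open>\<open>B\<close> takes only two values everywhere, whereas \<open>X\<close> is 0
    or 1 only almost surely; values of \<open>X\<close> other than 0 and 1 are sent to
    \<open>False\<close>.\<close>
  define B where "B i \<omega> \<longleftrightarrow> X i \<omega> = 1" for i \<omega>
  have meas [measurable]: "X i \<in> borel_measurable M" if "i \<ge> 1" for i
    using assms(2) that unfolding indep_vars_def by auto
  have prob_eq: "prob {\<omega> \<in> space M. X i \<omega> = c} = 1 / 2" if "i \<ge> 1" "c \<in> {0, 1}" for i c
  proof -
    have "prob {\<omega> \<in> space M. X i \<omega> = c} = measure (distr M borel (X i)) {c}"
      using that by (subst measure_distr) (auto intro!: arg_cong[of _ _ prob])
    also have "\<dots> = prob {\<omega> \<in> space M. X 1 \<omega> = c}"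
      unfolding assms(3)[OF that(1)] by (subst measure_distr) (auto intro!: arg_cong[of _ _ prob])
    finally show ?thesis using assms(4,5) that(2) by auto
  qed
  have ind: "indep_vars (\<lambda>_. count_space UNIV) B {1..}"
    unfolding B_def by (rule indep_vars_compose2[OF assms(2)]) measurable
  have half: "prob {\<omega> \<in> space M. B i \<omega> = c} = 1 / 2" if "i \<ge> 1" for i c
  proof (cases c)
    case True
    then show ?thesis using prob_eq[OF that, of 1] by (simp add: B_def)
  next
    case False
    have "prob {\<omega> \<in> space M. \<not> X i \<omega> = 1} = 1 - prob {\<omega> \<in> space M. X i \<omega> = 1}"
      using that by (intro prob_neg) measurable
    then show ?thesis using False prob_eq[OF that, of 1] by (simp add: B_def)
  qed
  have "AE \<omega> in M. X i \<omega> \<in> {0, 1}" if "i \<ge> 1" for i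
  proof -
    have ev: "{\<omega> \<in> space M. X i \<omega> = c} \<in> events" for c
      using that by measurable
    have "prob ({\<omega> \<in> space M. X i \<omega> = 0} \<union> {\<omega> \<in> space M. X i \<omega> = 1}) = 1"
      by (subst finite_measure_Union[OF ev ev]) (auto simp: prob_eq[OF that])
    then have "AE \<omega> in M. \<omega> \<in> {\<omega> \<in> space M. X i \<omega> = 0} \<union> {\<omega> \<in> space M. X i \<omega> = 1}"
      using ev by (subst (asm) AE_in_set_eq_1[symmetric]) auto
    then show ?thesis by eventually_elim auto
  qed
  \<comment> \<open>A union of countably many null sets is null.\<close>
  then have "AE \<omega> in M. \<forall>i\<in>{1..}. X i \<omega> \<in> {0, 1}"
    by (intro AE_ball_countable') auto
  moreover have "AE \<omega> in M. \<forall>\<^sub>F k in sequentially.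
    has_switch_run k (nat \<lceil>2 powr (real k + 1 + \<epsilon>) * ln (real k)\<rceil>) (\<lambda>i. B i \<omega>)"
    using ind half assms(6) by (rule AE_eventually_switch_run)
  ultimately show ?thesis
    using AE_space
  proof eventually_elim
    case (elim \<omega>)
    from elim(2) obtain K where K: "\<And>k. k \<ge> K \<Longrightarrow>
        has_switch_run k (nat \<lceil>2 powr (real k + 1 + \<epsilon>) * ln (real k)\<rceil>) (\<lambda>i. B i \<omega>)"
      unfolding eventually_sequentially by blast
    have "filterlim f at_top sequentially"
      unfolding f_def by real_asymp
    \<comment> \<open>The bound \<open>K\<close> is random, but \<omega> is fixed here. The summand
      2 provides \<open>k \<ge> 2\<close>, so that \<open>log 2 k\<close> is positive in
      \<open>run_length_threshold\<close>.\<close>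
    then have "\<forall>\<^sub>F N in sequentially. f N \<ge> real (K + 2)"
      unfolding filterlim_at_top by blast
    moreover have "\<forall>\<^sub>F N in sequentially. log 2 (log 2 (log 2 (real N))) \<ge> 0"
      by real_asymp
    moreover have "\<forall>\<^sub>F N in sequentially. real N \<ge> 4"
      by real_asymp
    ultimately have "\<forall>\<^sub>F N in sequentially. int (longest_switch_run M X N \<omega>) \<ge> \<lfloor>f N\<rfloor>"
    proof eventually_elim
      case (elim N)
      \<comment> \<open>Since \<open>f N\<close> is positive, \<open>nat\<close> does not truncate.
        The length at which \<open>k\<close> switches are guaranteed is at most \<open>N\<close>,
        and monotonicity in the length carries the run over to \<open>N\<close>.\<close>
      define k where "k = nat \<lfloor>f N\<rfloor>"
      have k: "int k = \<lfloor>f N\<rfloor>" "real k \<le> f N" "k \<ge> K + 2"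
        using elim(1) unfolding k_def by linarith+
      have "nat \<lceil>2 powr (real k + 1 + \<epsilon>) * ln (real k)\<rceil> \<le> N"
        using k elim assms(6) unfolding f_def by (intro run_length_threshold) auto
      with K[of k] k(3) have "has_switch_run k N (\<lambda>i. X i \<omega> = 1)"
        unfolding B_def by (meson has_switch_run_mono le_add1 le_trans)
      then have "k \<le> longest_switch_run M X N \<omega>"
        using \<open>\<omega> \<in> space M\<close> \<open>\<forall>i\<in>{1..}. X i \<omega> \<in> {0, 1}\<close> by (intro longest_switch_run_ge) auto
      then show ?case using k(1) by linarith
    qed
    then show ?case
      unfolding f_def eventually_sequentially .
  qed
qed

end
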